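(* Let $\Omega\subset\mathbb{R}^3$ be a domain, let $v:\Omega\to\mathbb{C}$ be a function, and let $\xi:\Omega\to\mathbb{C}$ be a twice continuously differentiable scalar function such that $\overrightarrow{h}=\operatorname{grad}\xi$ is a particular solution of the Riccati partial differential equation $$D\overrightarrow{f}+\overrightarrow{f}^{2}=v\quad\text{in }\Omega ,$$ that is, $D\overrightarrow{h}+\overrightarrow{h}^{2}=v$. Let $\Psi:\Omega\to\mathbb{C}$ be a twice continuously differentiable, nowhere vanishing scalar function which is a solution of the equation $$\triangle\Psi+2\left\langle\nabla\xi,\nabla\Psi\right\rangle=0\quad\text{in }\Omega,$$ or equivalently of $$\operatorname{div}(e^{2\xi}\nabla\Psi)=0\quad\text{in }\Omega$$ (these two equations for $\Psi$ being equivalent). Then, with $\overrightarrow{g}=\check{\partial}\Psi$, the function $$\overrightarrow{f}=\overrightarrow{g}+\overrightarrow{h}$$ is also a solution of $D\overrightarrow{f}+\overrightarrow{f}^{2}=v$ in $\Omega$.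
   Context: $\mathbb{H}(\mathbb{C})$ denotes the complex quaternions: elements $a=\sum_{k=0}^{3}a_k i_k$ with $a_k\in\mathbb{C}$, where $i_0=1$ is the unit, $i_k^2=-1$ for $k=1,2,3$, $i_1i_2=-i_2i_1=i_3$, $i_2i_3=-i_3i_2=i_1$, $i_3i_1=-i_1i_3=i_2$, and the complex unit $i$ commutes with every $i_k$. Scalars are identified with multiples of $i_0$; a vector (purely vectorial quaternion) is $\overrightarrow{a}=\sum_{k=1}^{3}a_k i_k$. The bracket $\langle\overrightarrow{a},\overrightarrow{b}\rangle=\sum_{k=1}^3a_kb_k$ is the bilinear inner product (no complex conjugation), and the quaternionic square of a vector is $\overrightarrow{a}^2=-\langle\overrightarrow{a},\overrightarrow{a}\rangle$. For a differentiable function $g:\Omega\to\mathbb{H}(\mathbb{C})$, the Moisil-Theodoresco operator is $Dg=\sum_{k=1}^{3}i_k\,\partial_k g$ with $\partial_k=\partial/\partial x_k$; for a scalar function $u$, $Du=\operatorname{grad}u=\nabla u=\sum_{k=1}^3 i_k\partial_k u$, and for a vector function, $D\overrightarrow{g}=-\operatorname{div}\overrightarrow{g}+\operatorname{rot}\overrightarrow{g}$ ($\operatorname{rot}$ is the curl). The logarithmic derivative of a nowhere vanishing scalar function $u$ is $\check{\partial}u=u^{-1}Du$. $\triangle$ is the three-dimensional Laplacian. *)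

theory Defs
  imports "HOL-Analysis.Analysis"
begin

section \<open>Complex quaternions\<close>

datatype biquat = Biquat (Q0: complex) (Q1: complex) (Q2: complex) (Q3: complex)

text \<open>\<^term>\<open>Biquat a b c d\<close> stands for \<open>a i\<^sub>0 + b i\<^sub>1 + c i\<^sub>2 + d i\<^sub>3\<close>.\<close>

lemma biquat_eq_iff: "x = y \<longleftrightarrow> Q0 x = Q0 y \<and> Q1 x = Q1 y \<and> Q2 x = Q2 y \<and> Q3 x = Q3 y"
  by (auto intro: biquat.expand)

instantiation biquat :: ring_1
begin

definition zero_biquat :: biquat where "0 = Biquat 0 0 0 0"

definition one_biquat :: biquat where "1 = Biquat 1 0 0 0"

definition plus_biquat :: "biquat \<Rightarrow> biquat \<Rightarrow> biquat" where
  "x + y = Biquat (Q0 x + Q0 y) (Q1 x + Q1 y) (Q2 x + Q2 y) (Q3 x + Q3 y)"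

definition uminus_biquat :: "biquat \<Rightarrow> biquat" where
  "- x = Biquat (- Q0 x) (- Q1 x) (- Q2 x) (- Q3 x)"

definition minus_biquat :: "biquat \<Rightarrow> biquat \<Rightarrow> biquat" where
  "x - y = Biquat (Q0 x - Q0 y) (Q1 x - Q1 y) (Q2 x - Q2 y) (Q3 x - Q3 y)"

definition times_biquat :: "biquat \<Rightarrow> biquat \<Rightarrow> biquat" where
  "x * y = Biquat
     (Q0 x * Q0 y - Q1 x * Q1 y - Q2 x * Q2 y - Q3 x * Q3 y)
     (Q0 x * Q1 y + Q1 x * Q0 y + Q2 x * Q3 y - Q3 x * Q2 y)
     (Q0 x * Q2 y - Q1 x * Q3 y + Q2 x * Q0 y + Q3 x * Q1 y)
     (Q0 x * Q3 y + Q1 x * Q2 y - Q2 x * Q1 y + Q3 x * Q0 y)"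

instance
  by standard
    (simp_all add: biquat_eq_iff zero_biquat_def one_biquat_def plus_biquat_def
      uminus_biquat_def minus_biquat_def times_biquat_def algebra_simps)

end

lemma biquat_ring_simps [simp]:
  "Q0 0 = 0" "Q1 0 = 0" "Q2 0 = 0" "Q3 0 = 0"
  "Q0 1 = 1" "Q1 1 = 0" "Q2 1 = 0" "Q3 1 = 0"
  "Q0 (x + y) = Q0 x + Q0 y" "Q1 (x + y) = Q1 x + Q1 y"
  "Q2 (x + y) = Q2 x + Q2 y" "Q3 (x + y) = Q3 x + Q3 y"
  "Q0 (- x) = - Q0 x" "Q1 (- x) = - Q1 x" "Q2 (- x) = - Q2 x" "Q3 (- x) = - Q3 x"
  "Q0 (x - y) = Q0 x - Q0 y" "Q1 (x - y) = Q1 x - Q1 y"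
  "Q2 (x - y) = Q2 x - Q2 y" "Q3 (x - y) = Q3 x - Q3 y"
  "Q0 (x * y) = Q0 x * Q0 y - Q1 x * Q1 y - Q2 x * Q2 y - Q3 x * Q3 y"
  "Q1 (x * y) = Q0 x * Q1 y + Q1 x * Q0 y + Q2 x * Q3 y - Q3 x * Q2 y"
  "Q2 (x * y) = Q0 x * Q2 y - Q1 x * Q3 y + Q2 x * Q0 y + Q3 x * Q1 y"
  "Q3 (x * y) = Q0 x * Q3 y + Q1 x * Q2 y - Q2 x * Q1 y + Q3 x * Q0 y"
  by (simp_all add: zero_biquat_def one_biquat_def plus_biquat_def
      uminus_biquat_def minus_biquat_def times_biquat_def)

text \<open>The Euclidean structure of \<open>\<complex>\<^sup>4 = \<real>\<^sup>8\<close>; it serves only to speak of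
  differentiability and derivatives of quaternion-valued functions.\<close>

instantiation biquat :: real_inner
begin

definition scaleR_biquat :: "real \<Rightarrow> biquat \<Rightarrow> biquat" where
  "r *\<^sub>R x = Biquat (r *\<^sub>R Q0 x) (r *\<^sub>R Q1 x) (r *\<^sub>R Q2 x) (r *\<^sub>R Q3 x)"

definition inner_biquat :: "biquat \<Rightarrow> biquat \<Rightarrow> real" where
  "x \<bullet> y = Q0 x \<bullet> Q0 y + Q1 x \<bullet> Q1 y + Q2 x \<bullet> Q2 y + Q3 x \<bullet> Q3 y"

definition norm_biquat_def: "norm x = sqrt (x \<bullet> x)" for x :: biquat

definition sgn_biquat_def: "sgn x = inverse (norm x) *\<^sub>R x" for x :: biquat

definition dist_biquat_def: "dist x y = norm (x - y)" for x y :: biquat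

definition uniformity_biquat_def:
  "(uniformity :: (biquat \<times> biquat) filter) = (INF e\<in>{0 <..}. principal {(x, y). dist x y < e})"

definition open_biquat_def:
  "open U \<longleftrightarrow> (\<forall>x\<in>U. eventually (\<lambda>(x', y). x' = x \<longrightarrow> y \<in> U) uniformity)"
  for U :: "biquat set"

instance
proof
  fix x y z :: biquat and r s :: real
  show "x \<bullet> x = 0 \<longleftrightarrow> x = 0"
  proof
    assume "x \<bullet> x = 0"
    then have "Q0 x \<bullet> Q0 x = 0 \<and> Q1 x \<bullet> Q1 x = 0 \<and> Q2 x \<bullet> Q2 x = 0 \<and> Q3 x \<bullet> Q3 x = 0"
      unfolding inner_biquat_def
      by (smt (verit) inner_ge_zero)
    then show "x = 0" by (simp add: biquat_eq_iff)
  qed (simp add: inner_biquat_def)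
qed (simp_all add: biquat_eq_iff scaleR_biquat_def inner_biquat_def norm_biquat_def
    sgn_biquat_def dist_biquat_def uniformity_biquat_def open_biquat_def
    inner_commute algebra_simps)

end

definition scal :: "complex \<Rightarrow> biquat" where
  "scal c = Biquat c 0 0 0"

definition iunit :: "3 \<Rightarrow> biquat" where
  "iunit k = (if k = 1 then Biquat 0 1 0 0 else if k = 2 then Biquat 0 0 1 0 else Biquat 0 0 0 1)"

lemma iunit_simps: "iunit 1 = Biquat 0 1 0 0" "iunit 2 = Biquat 0 0 1 0" "iunit 3 = Biquat 0 0 0 1"
  by (simp_all add: iunit_def)

lemma iunit_mult:
  "iunit k * iunit k = - 1"
  "iunit 1 * iunit 2 = iunit 3" "iunit 2 * iunit 1 = - iunit 3"
  "iunit 2 * iunit 3 = iunit 1" "iunit 3 * iunit 2 = - iunit 1"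
  "iunit 3 * iunit 1 = iunit 2" "iunit 1 * iunit 3 = - iunit 2"
  by (simp_all add: biquat_eq_iff iunit_def)

lemma scal_commute: "scal c * q = q * scal c"
  by (simp add: biquat_eq_iff scal_def algebra_simps)

lemma biquat_expansion:
  "q = scal (Q0 q) + scal (Q1 q) * iunit 1 + scal (Q2 q) * iunit 2 + scal (Q3 q) * iunit 3"
  by (simp add: biquat_eq_iff iunit_simps scal_def)

definition vectorial :: "biquat \<Rightarrow> bool" where
  "vectorial q \<longleftrightarrow> Q0 q = 0"

text \<open>Bilinear, without complex conjugation, unlike \<^const>\<open>inner\<close>.\<close>

definition bracket :: "biquat \<Rightarrow> biquat \<Rightarrow> complex" where
  "bracket a b = Q1 a * Q1 b + Q2 a * Q2 b + Q3 a * Q3 b"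

lemma vectorial_square: "vectorial a \<Longrightarrow> a\<^sup>2 = - scal (bracket a a)"
  by (simp add: biquat_eq_iff vectorial_def bracket_def scal_def power2_eq_square)


section \<open>Differential operators\<close>

definition pd :: "3 \<Rightarrow> (real^3 \<Rightarrow> 'a::real_normed_vector) \<Rightarrow> real^3 \<Rightarrow> 'a" where
  "pd k g x = vector_derivative (\<lambda>t. g (x + t *\<^sub>R axis k 1)) (at 0)"

text \<open>The next two predicates mean continuous differentiability for open \<open>S\<close> only:
  \<^const>\<open>pd\<close> also looks at points outside \<open>S\<close>.\<close>

definition C1_on :: "(real^3) set \<Rightarrow> (real^3 \<Rightarrow> 'a::real_normed_vector) \<Rightarrow> bool" where
  "C1_on S g \<longleftrightarrow> g differentiable_on S \<and> (\<forall>k. continuous_on S (pd k g))"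

definition C2_on :: "(real^3) set \<Rightarrow> (real^3 \<Rightarrow> 'a::real_normed_vector) \<Rightarrow> bool" where
  "C2_on S g \<longleftrightarrow> C1_on S g \<and> (\<forall>k. C1_on S (pd k g))"

definition moisil_theodoresco :: "(real^3 \<Rightarrow> biquat) \<Rightarrow> real^3 \<Rightarrow> biquat" where
  "moisil_theodoresco g x = (\<Sum>k\<in>UNIV. iunit k * pd k g x)"

definition grad :: "(real^3 \<Rightarrow> complex) \<Rightarrow> real^3 \<Rightarrow> biquat" where
  "grad u x = (\<Sum>k\<in>UNIV. iunit k * scal (pd k u x))"

definition divergence :: "(real^3 \<Rightarrow> biquat) \<Rightarrow> real^3 \<Rightarrow> complex" where
  "divergence g x = pd 1 (\<lambda>y. Q1 (g y)) x + pd 2 (\<lambda>y. Q2 (g y)) x + pd 3 (\<lambda>y. Q3 (g y)) x"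

definition laplacian :: "(real^3 \<Rightarrow> complex) \<Rightarrow> real^3 \<Rightarrow> complex" where
  "laplacian u x = (\<Sum>k\<in>UNIV. pd k (pd k u) x)"

definition log_deriv :: "(real^3 \<Rightarrow> complex) \<Rightarrow> real^3 \<Rightarrow> biquat" where
  "log_deriv u x = scal (inverse (u x)) * moisil_theodoresco (\<lambda>y. scal (u y)) x"

text \<open>Solutions of \<open>D f + f\<^sup>2 = v\<close> are differentiable, purely vectorial functions.
  Differentiability is required because \<^const>\<open>pd\<close> is total.\<close>

definition riccati_solution ::
    "(real^3) set \<Rightarrow> (real^3 \<Rightarrow> complex) \<Rightarrow> (real^3 \<Rightarrow> biquat) \<Rightarrow> bool" where
  "riccati_solution S v f \<longleftrightarrow>
     f differentiable_on S \<and>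
     (\<forall>x\<in>S. vectorial (f x) \<and> moisil_theodoresco f x + (f x)\<^sup>2 = scal (v x))"

lemma bounded_linear_scal: "bounded_linear scal"
  by (rule bounded_linear_intro[where K = 1])
    (simp_all add: biquat_eq_iff scal_def scaleR_biquat_def norm_biquat_def inner_biquat_def
      norm_eq_sqrt_inner)

lemma differentiable_imp_pd:
  fixes g :: "real^3 \<Rightarrow> 'a::real_normed_vector"
  assumes "g differentiable (at x)"
  shows "((\<lambda>t. g (x + t *\<^sub>R axis k 1)) has_vector_derivative pd k g x) (at 0)"
proof -
  have "((\<lambda>t::real. x + t *\<^sub>R axis k 1) has_derivative (\<lambda>t. t *\<^sub>R axis k 1)) (at 0)"
    by (auto intro!: derivative_eq_intros)
  moreover obtain g' where "(g has_derivative g') (at x)"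
    using assms by (auto simp: differentiable_def)
  ultimately have "(\<lambda>t. g (x + t *\<^sub>R axis k 1)) differentiable (at 0)"
    using has_derivative_compose[of "\<lambda>t. x + t *\<^sub>R axis k 1" _ 0 UNIV g g']
    by (auto simp: differentiable_def)
  then show ?thesis
    unfolding pd_def by (rule vector_derivative_works[THEN iffD1])
qed

lemma pd_bounded_linear:
  assumes "bounded_linear l" and "g differentiable (at x)"
  shows "pd k (\<lambda>y. l (g y)) x = l (pd k g x)"
  using bounded_linear.has_vector_derivative[OF assms(1) differentiable_imp_pd[OF assms(2)]]
  unfolding pd_def by (rule vector_derivative_at)

lemma moisil_theodoresco_scal:
  "u differentiable (at x) \<Longrightarrow> moisil_theodoresco (\<lambda>y. scal (u y)) x = grad u x"
  by (simp add: moisil_theodoresco_def grad_def pd_bounded_linear[OF bounded_linear_scal])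

definition curl :: "(real^3 \<Rightarrow> biquat) \<Rightarrow> real^3 \<Rightarrow> biquat" where
  "curl g x = Biquat 0
     (pd 2 (\<lambda>y. Q3 (g y)) x - pd 3 (\<lambda>y. Q2 (g y)) x)
     (pd 3 (\<lambda>y. Q1 (g y)) x - pd 1 (\<lambda>y. Q3 (g y)) x)
     (pd 1 (\<lambda>y. Q2 (g y)) x - pd 2 (\<lambda>y. Q1 (g y)) x)"

lemma norm_biquat_components:
  "norm (Q0 x) \<le> norm x" "norm (Q1 x) \<le> norm x" "norm (Q2 x) \<le> norm x" "norm (Q3 x) \<le> norm x"
  by (simp_all add: norm_biquat_def inner_biquat_def norm_eq_sqrt_inner)

lemma bounded_linear_components:
  "bounded_linear Q0" "bounded_linear Q1" "bounded_linear Q2" "bounded_linear Q3"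
  by (auto intro!: bounded_linear_intro[where K = 1]
      simp: norm_biquat_components scaleR_biquat_def)

lemma moisil_theodoresco_vectorial:
  assumes "\<And>y. vectorial (g y)" and "g differentiable (at x)"
  shows "moisil_theodoresco g x = - scal (divergence g x) + curl g x"
proof -
  have "Q0 (pd k g x) = 0" for k
    using pd_bounded_linear[OF bounded_linear_components(1) assms(2), of k] assms(1)
    by (simp add: vectorial_def pd_def)
  then show ?thesis
    using assms(2)
    by (simp add: biquat_eq_iff moisil_theodoresco_def sum_3 iunit_simps scal_def curl_def
        divergence_def pd_bounded_linear[OF bounded_linear_components(2)]
        pd_bounded_linear[OF bounded_linear_components(3)]
        pd_bounded_linear[OF bounded_linear_components(4)])
qed

end

theory Submission
  imports Defs
begin

text \<open>For vectors, \<open>g h + h g = - 2 \<langle>g, h\<rangle>\<close>, so \<open>f = g + h\<close> satisfies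
  \<open>D f + f\<^sup>2 = (D h + h\<^sup>2) + (D g + g\<^sup>2) - 2 \<langle>g, h\<rangle>\<close>. For a logarithmic derivative
  \<open>g = \<nabla>\<Psi> / \<Psi>\<close> the Riccati expression linearises: \<open>D g + g\<^sup>2 = - \<triangle>\<Psi> / \<Psi>\<close>, where the curl
  vanishes because mixed second partial derivatives commute. What is left over is
  \<open>- (\<triangle>\<Psi> + 2 \<langle>\<nabla>\<xi>, \<nabla>\<Psi>\<rangle>) / \<Psi>\<close>.\<close>

section \<open>Symmetry of mixed derivatives\<close>

text \<open>Chain rule for the shift \<open>t - s\<close>. Directional derivatives are given at
  parameter 0 of each base point, while the mean value theorem needs them at every parameter of one
  fixed line.\<close>

lemma has_vector_derivative_along_line:
  fixes f :: "'a::real_normed_vector \<Rightarrow> 'b::real_normed_vector"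
  assumes "((\<lambda>t. f ((y + s *\<^sub>R a) + t *\<^sub>R a)) has_vector_derivative d) (at 0)"
  shows "((\<lambda>t. f (y + t *\<^sub>R a)) has_vector_derivative d) (at s)"
proof -
  have "((\<lambda>t. f ((y + s *\<^sub>R a) + (t - s) *\<^sub>R a)) has_vector_derivative 1 *\<^sub>R d) (at s)"
    by (rule vector_diff_chain_at[of "\<lambda>t. t - s" 1 s, unfolded o_def])
      (use assms in \<open>auto intro!: derivative_eq_intros\<close>)
  then show ?thesis
    by (simp add: algebra_simps)
qed

text \<open>The mean value theorem is applied twice: along \<open>a\<close> to an increment of
  \<open>f\<close> in direction \<open>b\<close>, then along \<open>b\<close> to \<open>fa\<close>.
  Each application contributes one factor \<open>h\<close>.\<close>

lemma second_difference_mean_value: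
  fixes f fa fab :: "'a::real_normed_vector \<Rightarrow> real"
  assumes fa: "\<And>y. y \<in> S \<Longrightarrow> ((\<lambda>t. f (y + t *\<^sub>R a)) has_vector_derivative fa y) (at 0)"
    and fab: "\<And>y. y \<in> S \<Longrightarrow> ((\<lambda>t. fa (y + t *\<^sub>R b)) has_vector_derivative fab y) (at 0)"
    and S: "\<And>s t. 0 \<le> s \<Longrightarrow> s \<le> h \<Longrightarrow> 0 \<le> t \<Longrightarrow> t \<le> h \<Longrightarrow> x + s *\<^sub>R a + t *\<^sub>R b \<in> S"
    and h: "0 < h"
  obtains s t where "0 < s" "s < h" "0 < t" "t < h"
    "f (x + h *\<^sub>R a + h *\<^sub>R b) - f (x + h *\<^sub>R a) - f (x + h *\<^sub>R b) + f x
      = h\<^sup>2 * fab (x + s *\<^sub>R a + t *\<^sub>R b)"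
proof -
  \<comment> \<open>The second difference of \<open>f\<close> is
    \<open>\<phi> h - \<phi> 0\<close>.\<close>
  define \<phi> where "\<phi> s = f ((x + h *\<^sub>R b) + s *\<^sub>R a) - f (x + s *\<^sub>R a)" for s
  have "(\<phi> has_real_derivative fa (x + s *\<^sub>R a + h *\<^sub>R b) - fa (x + s *\<^sub>R a)) (at s)"
    if "0 \<le> s" "s \<le> h" for s
  proof -
    have "((\<lambda>t. f ((x + h *\<^sub>R b) + t *\<^sub>R a)) has_vector_derivative fa (x + s *\<^sub>R a + h *\<^sub>R b)) (at s)"
      using fa[OF S[of s h]] that h
      by - (rule has_vector_derivative_along_line, simp add: add_ac)
    moreover have "((\<lambda>t. f (x + t *\<^sub>R a)) has_vector_derivative fa (x + s *\<^sub>R a)) (at s)"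
      using fa[OF S[of s 0]] that h by - (rule has_vector_derivative_along_line, simp)
    ultimately show ?thesis
      unfolding \<phi>_def has_real_derivative_iff_has_vector_derivative
      by (rule has_vector_derivative_diff)
  qed
  from MVT2[OF h this] obtain s where s: "0 < s" "s < h"
    and \<phi>: "\<phi> h - \<phi> 0 = h * (fa (x + s *\<^sub>R a + h *\<^sub>R b) - fa (x + s *\<^sub>R a))"
    by auto
  have "((\<lambda>t. fa (x + s *\<^sub>R a + t *\<^sub>R b)) has_real_derivative fab (x + s *\<^sub>R a + t *\<^sub>R b)) (at t)"
    if "0 \<le> t" "t \<le> h" for t
    unfolding has_real_derivative_iff_has_vector_derivative
    using fab[OF S[of s t]] that s by - (rule has_vector_derivative_along_line, simp)
  from MVT2[OF h this] obtain t where t: "0 < t" "t < h"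
    and "fa (x + s *\<^sub>R a + h *\<^sub>R b) - fa (x + s *\<^sub>R a) = h * fab (x + s *\<^sub>R a + t *\<^sub>R b)"
    by auto
  with \<phi> have "f (x + h *\<^sub>R a + h *\<^sub>R b) - f (x + h *\<^sub>R a) - f (x + h *\<^sub>R b) + f x
      = h\<^sup>2 * fab (x + s *\<^sub>R a + t *\<^sub>R b)"
    by (simp add: \<phi>_def power2_eq_square add_ac)
  with s t show ?thesis by (rule that)
qed

text \<open>The second difference is symmetric in \<open>a\<close> and \<open>b\<close>, so
  \<open>fab\<close> and \<open>fba\<close> take a common value, at two possibly different points
  arbitrarily close to \<open>x\<close>. Continuity at \<open>x\<close> then forces equality
  there.\<close>

lemma mixed_derivatives_commute_real:
  fixes f fa fb fab fba :: "'a::real_normed_vector \<Rightarrow> real"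
  assumes "open S" "x \<in> S"
    and fa: "\<And>y. y \<in> S \<Longrightarrow> ((\<lambda>t. f (y + t *\<^sub>R a)) has_vector_derivative fa y) (at 0)"
    and fb: "\<And>y. y \<in> S \<Longrightarrow> ((\<lambda>t. f (y + t *\<^sub>R b)) has_vector_derivative fb y) (at 0)"
    and fab: "\<And>y. y \<in> S \<Longrightarrow> ((\<lambda>t. fa (y + t *\<^sub>R b)) has_vector_derivative fab y) (at 0)"
    and fba: "\<And>y. y \<in> S \<Longrightarrow> ((\<lambda>t. fb (y + t *\<^sub>R a)) has_vector_derivative fba y) (at 0)"
    and cont: "continuous_on S fab" "continuous_on S fba"
  shows "fab x = fba x"
proof (rule ccontr)
  assume neq: "fab x \<noteq> fba x"
  \<comment> \<open>Half the gap: no number lies within less than \<open>e\<close> of both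
    \<open>fab x\<close> and \<open>fba x\<close>.\<close>
  define e where "e = \<bar>fab x - fba x\<bar> / 2"
  have e: "0 < e" using neq by (simp add: e_def)
  have lim: "(fab \<longlongrightarrow> fab x) (nhds x)" "(fba \<longlongrightarrow> fba x) (nhds x)"
    using cont assms(1,2) by (auto simp: continuous_on_eq_continuous_at isCont_def tendsto_at_iff_tendsto_nhds)
  have "\<forall>\<^sub>F y in nhds x. dist (fab y) (fab x) < e \<and> dist (fba y) (fba x) < e \<and> y \<in> S"
    using tendstoD[OF lim(1) e] tendstoD[OF lim(2) e] eventually_nhds_in_open[OF assms(1,2)]
    by eventually_elim simp
  then obtain r where r: "0 < r"
    and near: "\<And>y. dist y x < r \<Longrightarrow>
      dist (fab y) (fab x) < e \<and> dist (fba y) (fba x) < e \<and> y \<in> S"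
    unfolding eventually_nhds_metric by blast
  \<comment> \<open>This keeps the whole parallelogram with sides \<open>h *\<^sub>R a\<close> and
    \<open>h *\<^sub>R b\<close> within distance \<open>r\<close> of \<open>x\<close>; the summand 1
    makes the denominator positive even if both directions vanish.\<close>
  define h where "h = r / (norm a + norm b + 1)"
  have h: "0 < h" using r by (simp add: h_def add_nonneg_pos)
  have "h * (norm a + norm b + 1) = r"
    unfolding h_def using add_nonneg_pos[of "norm a + norm b" 1] by simp
  then have hr: "h * norm a + h * norm b < r" using h by (simp add: algebra_simps)
  have ball: "dist (x + s *\<^sub>R a + t *\<^sub>R b) x < r"
    if "0 \<le> s" "s \<le> h" "0 \<le> t" "t \<le> h" for s t
  proof -
    have "dist (x + s *\<^sub>R a + t *\<^sub>R b) x = norm (s *\<^sub>R a + t *\<^sub>R b)"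
      by (simp add: dist_norm add.assoc)
    also have "\<dots> \<le> s * norm a + t * norm b"
      using norm_triangle_ineq[of "s *\<^sub>R a" "t *\<^sub>R b"] that by simp
    also have "\<dots> \<le> h * norm a + h * norm b"
      using that by (intro add_mono mult_right_mono) auto
    finally show ?thesis using hr by simp
  qed
  obtain s t where st: "0 < s" "s < h" "0 < t" "t < h"
    and 1: "f (x + h *\<^sub>R a + h *\<^sub>R b) - f (x + h *\<^sub>R a) - f (x + h *\<^sub>R b) + f x
      = h\<^sup>2 * fab (x + s *\<^sub>R a + t *\<^sub>R b)"
    by (rule second_difference_mean_value[OF fa fab _ h, where x = x]) (use near ball in blast)+
  have ball': "dist (x + s *\<^sub>R b + t *\<^sub>R a) x < r"
    if "0 \<le> s" "s \<le> h" "0 \<le> t" "t \<le> h" for s t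
    using ball[of t s] that by (simp add: add_ac)
  obtain s' t' where st': "0 < s'" "s' < h" "0 < t'" "t' < h"
    and 2: "f (x + h *\<^sub>R b + h *\<^sub>R a) - f (x + h *\<^sub>R b) - f (x + h *\<^sub>R a) + f x
      = h\<^sup>2 * fba (x + s' *\<^sub>R b + t' *\<^sub>R a)"
    by (rule second_difference_mean_value[OF fb fba _ h, where x = x]) (use near ball' in blast)+
  have "h\<^sup>2 * fab (x + s *\<^sub>R a + t *\<^sub>R b) = h\<^sup>2 * fba (x + s' *\<^sub>R b + t' *\<^sub>R a)"
    unfolding 1[symmetric] 2[symmetric] by (simp add: add_ac)
  then have "fab (x + s *\<^sub>R a + t *\<^sub>R b) = fba (x + s' *\<^sub>R b + t' *\<^sub>R a)"
    using h by simp
  moreover have "dist (fab (x + s *\<^sub>R a + t *\<^sub>R b)) (fab x) < e"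
    using near[OF ball[of s t]] st by simp
  moreover have "dist (fba (x + s' *\<^sub>R b + t' *\<^sub>R a)) (fba x) < e"
    using near[OF ball'[of s' t']] st' by simp
  ultimately have "dist (fab x) (fba x) < 2 * e"
    using dist_triangle_half_r[of "fab (x + s *\<^sub>R a + t *\<^sub>R b)" "fab x" "2 * e" "fba x"] by simp
  then show False by (simp add: e_def dist_real_def)
qed

text \<open>The mean value theorem with an exact intermediate point is a real-valued statement, so
  the real case is applied to the inner product with each fixed \<open>c\<close>; these inner
  products determine a vector.\<close>

lemma mixed_derivatives_commute:
  fixes f fa fb fab fba :: "'a::real_normed_vector \<Rightarrow> 'b::real_inner"
  assumes "open S" "x \<in> S"
    and "\<And>y. y \<in> S \<Longrightarrow> ((\<lambda>t. f (y + t *\<^sub>R a)) has_vector_derivative fa y) (at 0)"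
    and "\<And>y. y \<in> S \<Longrightarrow> ((\<lambda>t. f (y + t *\<^sub>R b)) has_vector_derivative fb y) (at 0)"
    and "\<And>y. y \<in> S \<Longrightarrow> ((\<lambda>t. fa (y + t *\<^sub>R b)) has_vector_derivative fab y) (at 0)"
    and "\<And>y. y \<in> S \<Longrightarrow> ((\<lambda>t. fb (y + t *\<^sub>R a)) has_vector_derivative fba y) (at 0)"
    and "continuous_on S fab" "continuous_on S fba"
  shows "fab x = fba x"
proof -
  note * = bounded_linear.has_vector_derivative[OF bounded_linear_inner_left]
  have "fab x \<bullet> c = fba x \<bullet> c" for c
    by (rule mixed_derivatives_commute_real[of S x "\<lambda>y. f y \<bullet> c" a "\<lambda>y. fa y \<bullet> c" b "\<lambda>y. fb y \<bullet> c"])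
      (use assms in \<open>auto intro!: * continuous_intros\<close>)
  then show ?thesis by (metis vector_eq_rdot)
qed

section \<open>Calculus of partial derivatives\<close>

lemma C1_on_differentiable: "C1_on S g \<Longrightarrow> open S \<Longrightarrow> x \<in> S \<Longrightarrow> g differentiable (at x)"
  by (auto simp: C1_on_def differentiable_on_eq_differentiable_at)

lemma C2_on_differentiable:
  assumes "C2_on S g" "open S" "x \<in> S"
  shows "g differentiable (at x)" "pd k g differentiable (at x)"
  using assms by (auto simp: C2_on_def intro: C1_on_differentiable)

lemma pd_commute:
  fixes u :: "real^3 \<Rightarrow> complex"
  assumes "C2_on S u" "open S" "x \<in> S"
  shows "pd j (pd k u) x = pd k (pd j u) x"
  by (rule mixed_derivatives_commute[OF assms(2,3), where f = u])
    (use assms in \<open>auto intro!: differentiable_imp_pd C2_on_differentiable simp: C2_on_def C1_on_def\<close>)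

lemma pd_eqI:
  "((\<lambda>t. g (x + t *\<^sub>R axis k 1)) has_vector_derivative d) (at 0) \<Longrightarrow> pd k g x = d"
  unfolding pd_def by (rule vector_derivative_at)

lemma pd_add:
  assumes "f differentiable (at x)" "g differentiable (at x)"
  shows "pd k (\<lambda>y. f y + g y) x = pd k f x + pd k g x"
  by (intro pd_eqI has_vector_derivative_add differentiable_imp_pd assms)

lemma pd_mult:
  fixes f g :: "real^3 \<Rightarrow> complex"
  assumes "f differentiable (at x)" "g differentiable (at x)"
  shows "pd k (\<lambda>y. f y * g y) x = f x * pd k g x + pd k f x * g x"
  using has_vector_derivative_mult[OF differentiable_imp_pd[OF assms(1), of k]
      differentiable_imp_pd[OF assms(2), of k]]
  by (intro pd_eqI) simp

lemma pd_chain: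
  fixes f :: "real^3 \<Rightarrow> complex"
  assumes "f differentiable (at x)" "(\<phi> has_field_derivative d) (at (f x))"
  shows "pd k (\<lambda>y. \<phi> (f y)) x = pd k f x * d"
  using field_vector_diff_chain_at[OF differentiable_imp_pd[OF assms(1), of k], of \<phi> d] assms(2)
  by (intro pd_eqI) (simp add: o_def)

text \<open>The line through \<open>x\<close> stays in the open set \<open>S\<close> for small
  parameters, so values outside \<open>S\<close> do not influence \<open>pd\<close> at
  \<open>x\<close>.\<close>

lemma pd_cong_open:
  assumes "open S" "x \<in> S" "\<And>y. y \<in> S \<Longrightarrow> f y = g y"
  shows "pd k f x = pd k g x"
proof -
  have "((\<lambda>t. x + t *\<^sub>R axis k 1) \<longlongrightarrow> x + 0 *\<^sub>R axis k 1) (nhds (0::real))"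
    by (intro tendsto_intros filterlim_ident)
  then have "\<forall>\<^sub>F t in nhds (0::real). x + t *\<^sub>R axis k 1 \<in> S"
    using assms(1,2) by (intro topological_tendstoD) auto
  then have "\<forall>\<^sub>F t in nhds (0::real). f (x + t *\<^sub>R axis k 1) = g (x + t *\<^sub>R axis k 1)"
    by eventually_elim (use assms(3) in blast)
  then show ?thesis
    unfolding pd_def by (intro vector_derivative_cong_eq) auto
qed

lemma differentiable_compose_field:
  fixes f :: "'a::real_normed_vector \<Rightarrow> complex"
  assumes "f differentiable (at x)" "(\<phi> has_field_derivative d) (at (f x))"
  shows "(\<lambda>y. \<phi> (f y)) differentiable (at x)"
  using assms differentiable_chain_at[of f x \<phi>]
  by (auto simp: o_def has_field_derivative_def differentiable_def)

section \<open>Vector fields\<close>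

text \<open>A common form for \<open>grad\<close> and \<open>log_deriv\<close>, which lets both be
  differentiated componentwise.\<close>

definition vquat :: "(3 \<Rightarrow> complex) \<Rightarrow> biquat" where
  "vquat u = (\<Sum>k\<in>UNIV. iunit k * scal (u k))"

lemma vquat_eq: "vquat u = Biquat 0 (u 1) (u 2) (u 3)"
  by (simp add: vquat_def sum_3 iunit_simps scal_def biquat_eq_iff)

lemma grad_eq_vquat: "grad u x = vquat (\<lambda>k. pd k u x)"
  by (simp add: grad_def vquat_def)

lemma bounded_linear_vquat_component: "bounded_linear (\<lambda>c. iunit k * scal c)"
  by (rule bounded_linear_intro[where K = 1])
    (simp_all add: biquat_eq_iff iunit_def scal_def scaleR_biquat_def norm_biquat_def
      inner_biquat_def norm_eq_sqrt_inner)

lemma vquat_field: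
  assumes "\<And>k. u k differentiable (at x)"
  shows differentiable_vquat: "(\<lambda>y. vquat (\<lambda>k. u k y)) differentiable (at x)"
    and pd_vquat: "pd j (\<lambda>y. vquat (\<lambda>k. u k y)) x = vquat (\<lambda>k. pd j (u k) x)"
proof -
  have *: "(\<lambda>y. iunit k * scal (u k y)) differentiable (at x)" for k
    using assms[of k] bounded_linear.has_derivative[OF bounded_linear_vquat_component]
    unfolding differentiable_def by blast
  show "(\<lambda>y. vquat (\<lambda>k. u k y)) differentiable (at x)"
    unfolding vquat_def using * by simp
  show "pd j (\<lambda>y. vquat (\<lambda>k. u k y)) x = vquat (\<lambda>k. pd j (u k) x)"
    by (simp add: vquat_def sum_3 pd_add * differentiable_add
        pd_bounded_linear[OF bounded_linear_vquat_component] assms)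
qed

text \<open>Product rule, with \<open>2 * exp (2 * \<xi> x)\<close> times the gradient of
  \<open>\<xi>\<close> as the gradient of the exponential weight. This links the divergence form of
  the equation for \<open>\<Psi>\<close> to the form with the Laplacian.\<close>

lemma divergence_scaled_grad:
  assumes \<xi>: "\<xi> differentiable (at x)" and \<Psi>: "\<And>k. pd k \<Psi> differentiable (at x)"
  shows "divergence (\<lambda>y. scal (exp (2 * \<xi> y)) * grad \<Psi> y) x
    = exp (2 * \<xi> x) * (laplacian \<Psi> x + 2 * bracket (grad \<xi> x) (grad \<Psi> x))"
proof -
  have d: "((\<lambda>z. exp (2 * z)) has_field_derivative 2 * exp (2 * \<xi> x)) (at (\<xi> x))"
    by (auto intro!: derivative_eq_intros)
  show ?thesis
    by (simp add: divergence_def grad_eq_vquat vquat_eq scal_def laplacian_def sum_3 bracket_def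
        pd_mult[OF differentiable_compose_field[OF \<xi> d] \<Psi>] pd_chain[OF \<xi> d])
      (simp add: algebra_simps)
qed

text \<open>The cross product parts of the two products are antisymmetric and cancel, while the
  scalar parts agree and add up.\<close>

lemma vectorial_anticommutator:
  "vectorial a \<Longrightarrow> vectorial b \<Longrightarrow> a * b + b * a = - scal (2 * bracket a b)"
  by (simp add: vectorial_def biquat_eq_iff scal_def bracket_def algebra_simps)

section \<open>The logarithmic derivative and its Riccati expression\<close>

lemma log_deriv_eq_vquat:
  "\<Psi> differentiable (at x) \<Longrightarrow> log_deriv \<Psi> x = vquat (\<lambda>k. inverse (\<Psi> x) * pd k \<Psi> x)"
  by (simp add: log_deriv_def moisil_theodoresco_scal grad_eq_vquat vquat_eq biquat_eq_iff)
    (simp add: scal_def)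

text \<open>Differentiating \<open>inverse \<Psi>\<close> yields the terms
  \<open>- pd j \<Psi> x * pd k \<Psi> x / (\<Psi> x)\<^sup>2\<close>. Being symmetric in
  \<open>j\<close> and \<open>k\<close>, they drop out of the curl; on the diagonal they add the
  bracket of the logarithmic derivative with itself to the scalar part, which its quaternionic
  square cancels.\<close>

lemma log_deriv_riccati:
  assumes C2: "C2_on S \<Psi>" and S: "open S" "x \<in> S" and nz: "\<And>y. y \<in> S \<Longrightarrow> \<Psi> y \<noteq> 0"
  shows "log_deriv \<Psi> differentiable (at x)"
    and "moisil_theodoresco (log_deriv \<Psi>) x + (log_deriv \<Psi> x)\<^sup>2 = - scal (laplacian \<Psi> x / \<Psi> x)"
proof -
  note \<Psi> = C2_on_differentiable[OF C2 S]
  let ?g = "\<lambda>y. vquat (\<lambda>k. inverse (\<Psi> y) * pd k \<Psi> y)"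
  \<comment> \<open>The componentwise formula relies on differentiability of \<open>\<Psi>\<close>,
    so it is available on \<open>S\<close> only; openness of \<open>S\<close> is what transfers
    derivatives from \<open>?g\<close> to \<open>log_deriv \<Psi>\<close>.\<close>
  have eq: "log_deriv \<Psi> y = ?g y" if "y \<in> S" for y
    using that C2 S(1) by (intro log_deriv_eq_vquat C2_on_differentiable)
  have d: "(inverse has_field_derivative - (inverse (\<Psi> x))\<^sup>2) (at (\<Psi> x))"
    using nz[OF S(2)] by (auto intro!: derivative_eq_intros simp: power2_eq_square)
  note inv = differentiable_compose_field[OF \<Psi>(1) d]
  have comp: "(\<lambda>y. inverse (\<Psi> y) * pd k \<Psi> y) differentiable (at x)" for k
    by (intro differentiable_mult inv \<Psi>)
  have "?g differentiable (at x)"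
    by (rule differentiable_vquat[OF comp])
  then obtain D where "(?g has_derivative D) (at x)"
    by (auto simp: differentiable_def)
  then have "(log_deriv \<Psi> has_derivative D) (at x)"
    by (rule has_derivative_transform_within_open[OF _ S]) (simp add: eq)
  then show "log_deriv \<Psi> differentiable (at x)"
    by (auto simp: differentiable_def)
  have pd: "pd j (log_deriv \<Psi>) x
      = vquat (\<lambda>k. inverse (\<Psi> x) * pd j (pd k \<Psi>) x - pd j \<Psi> x * pd k \<Psi> x * (inverse (\<Psi> x))\<^sup>2)" for j
    using pd_cong_open[OF S eq, where k = j]
    by (simp add: pd_vquat[OF comp] pd_mult[OF inv \<Psi>(2)] pd_chain[OF \<Psi>(1) d] mult_ac)
  show "moisil_theodoresco (log_deriv \<Psi>) x + (log_deriv \<Psi> x)\<^sup>2 = - scal (laplacian \<Psi> x / \<Psi> x)"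
    \<comment> \<open>One index pair for each component of the curl.\<close>
    using pd_commute[OF C2 S, of 2 1] pd_commute[OF C2 S, of 3 1] pd_commute[OF C2 S, of 3 2]
    by (simp add: moisil_theodoresco_def sum_3 pd eq[OF S(2)] vquat_eq iunit_simps biquat_eq_iff
        scal_def laplacian_def power2_eq_square algebra_simps divide_inverse)
qed

lemma moisil_theodoresco_add:
  assumes "f differentiable (at x)" "g differentiable (at x)"
  shows "moisil_theodoresco (\<lambda>y. f y + g y) x = moisil_theodoresco f x + moisil_theodoresco g x"
  by (simp add: moisil_theodoresco_def pd_add[OF assms] distrib_left sum.distrib)

theorem proposition3:
  fixes \<Omega> :: "(real^3) set" and v \<xi> \<Psi> :: "real^3 \<Rightarrow> complex"
  assumes "open \<Omega>" and "connected \<Omega>" and "\<Omega> \<noteq> {}"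
    and "C2_on \<Omega> \<xi>"
    and "riccati_solution \<Omega> v (grad \<xi>)"
    and "C2_on \<Omega> \<Psi>"
    and "\<forall>x\<in>\<Omega>. \<Psi> x \<noteq> 0"
  shows "((\<forall>x\<in>\<Omega>. laplacian \<Psi> x + 2 * bracket (grad \<xi> x) (grad \<Psi> x) = 0) \<longleftrightarrow>
          (\<forall>x\<in>\<Omega>. divergence (\<lambda>y. scal (exp (2 * \<xi> y)) * grad \<Psi> y) x = 0)) \<and>
         ((\<forall>x\<in>\<Omega>. laplacian \<Psi> x + 2 * bracket (grad \<xi> x) (grad \<Psi> x) = 0) \<longrightarrow>
          riccati_solution \<Omega> v (\<lambda>x. log_deriv \<Psi> x + grad \<xi> x))"
proof (intro conjI impI)
  show "(\<forall>x\<in>\<Omega>. laplacian \<Psi> x + 2 * bracket (grad \<xi> x) (grad \<Psi> x) = 0) \<longleftrightarrow>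
      (\<forall>x\<in>\<Omega>. divergence (\<lambda>y. scal (exp (2 * \<xi> y)) * grad \<Psi> y) x = 0)"
    \<comment> \<open>The two expressions differ by the factor \<open>exp (2 * \<xi> x)\<close>,
      which is never zero, so they vanish at the same points.\<close>
    using assms(1,4,6) by (simp add: divergence_scaled_grad C2_on_differentiable)
next
  assume pde: "\<forall>x\<in>\<Omega>. laplacian \<Psi> x + 2 * bracket (grad \<xi> x) (grad \<Psi> x) = 0"
  have grad_diff: "grad \<xi> differentiable (at x)" if "x \<in> \<Omega>" for x
    using assms(1,5) that by (auto simp: riccati_solution_def differentiable_on_eq_differentiable_at)
  have log_diff: "log_deriv \<Psi> differentiable (at x)" if "x \<in> \<Omega>" for x
    using log_deriv_riccati(1)[OF assms(6,1) that] assms(7) by blast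
  have "vectorial (log_deriv \<Psi> x + grad \<xi> x) \<and>
      moisil_theodoresco (\<lambda>x. log_deriv \<Psi> x + grad \<xi> x) x + (log_deriv \<Psi> x + grad \<xi> x)\<^sup>2
        = scal (v x)" if x: "x \<in> \<Omega>" for x
  proof -
    let ?g = "log_deriv \<Psi>" and ?h = "grad \<xi>"
    have nz: "\<Psi> x \<noteq> 0" using assms(7) x by blast
    have g: "?g x = vquat (\<lambda>k. inverse (\<Psi> x) * pd k \<Psi> x)"
      using C2_on_differentiable(1)[OF assms(6,1) x] by (rule log_deriv_eq_vquat)
    have vect: "vectorial (?g x)" "vectorial (?h x)"
      by (simp_all add: g grad_eq_vquat vquat_eq vectorial_def)
    have riccati_h: "moisil_theodoresco ?h x + (?h x)\<^sup>2 = scal (v x)"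
      using assms(5) x by (simp add: riccati_solution_def)
    have riccati_g: "moisil_theodoresco ?g x + (?g x)\<^sup>2 = - scal (laplacian \<Psi> x / \<Psi> x)"
      using log_deriv_riccati(2)[OF assms(6,1) x] assms(7) by blast
    \<comment> \<open>The bracket is symmetric and complex bilinear, so the factor
      \<open>inverse (\<Psi> x)\<close> of \<open>?g x\<close> comes out without
      conjugation.\<close>
    have bracket: "bracket (?g x) (?h x) = bracket (?h x) (grad \<Psi> x) / \<Psi> x"
      by (simp add: g grad_eq_vquat vquat_eq bracket_def divide_inverse algebra_simps)
    have "laplacian \<Psi> x / \<Psi> x + 2 * bracket (?g x) (?h x)
        = (laplacian \<Psi> x + 2 * bracket (?h x) (grad \<Psi> x)) / \<Psi> x"
      by (simp add: bracket add_divide_distrib)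
    then have zero: "laplacian \<Psi> x / \<Psi> x + 2 * bracket (?g x) (?h x) = 0"
      using pde x by simp
    \<comment> \<open>Multiplication is not commutative, so the mixed terms of the square stay
      together as an anticommutator.\<close>
    have "moisil_theodoresco (\<lambda>x. ?g x + ?h x) x + (?g x + ?h x)\<^sup>2
      = (moisil_theodoresco ?h x + (?h x)\<^sup>2) + (moisil_theodoresco ?g x + (?g x)\<^sup>2)
        + (?g x * ?h x + ?h x * ?g x)"
      by (simp add: moisil_theodoresco_add log_diff grad_diff x power2_eq_square distrib_left
          distrib_right add_ac)
    also have "\<dots> = scal (v x) - scal (laplacian \<Psi> x / \<Psi> x + 2 * bracket (?g x) (?h x))"
      unfolding riccati_h riccati_g vectorial_anticommutator[OF vect]
      by (simp add: scal_def biquat_eq_iff)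
    also have "\<dots> = scal (v x)"
      unfolding zero by (simp add: scal_def biquat_eq_iff)
    finally show ?thesis
      using vect by (simp add: vectorial_def)
  qed
  then show "riccati_solution \<Omega> v (\<lambda>x. log_deriv \<Psi> x + grad \<xi> x)"
    unfolding riccati_solution_def
    by (auto intro!: differentiable_at_imp_differentiable_on differentiable_add log_diff grad_diff)
qed

end
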